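(* Let $k\ge 1$ and let $\Lambda$ be a source-free, row-finite $k$-graph. For $0\le j\le k$ let $\mathcal{D}^j$, with differentials $\partial^j_p$, denote the Evans chain complex of the $j$-graph $\Lambda_j=\iota_j^*(\Lambda)$. Then for all $1\le j\le k$ and $1\le p\le j$, with respect to the decompositions $\mathcal{D}^j_p\cong\mathcal{D}^{j-1}_{p-1}\oplus\mathcal{D}^{j-1}_p$ and $\mathcal{D}^j_{p-1}\cong\mathcal{D}^{j-1}_{p-2}\oplus\mathcal{D}^{j-1}_{p-1}$ described in the context, the differential has the block form $$\partial^j_p=\begin{bmatrix}\partial^{j-1}_{p-1} & 0\\ (-1)^{p+1}B_j & \partial^{j-1}_p\end{bmatrix},$$ where $B_j$ acts coordinate-wise on vectors of $\mathcal{D}^{j-1}_{p-1}=\bigoplus_{N_{p-1,j-1}}\mathbb{Z}\Lambda^0$, and where blocks $\partial^{\ell}_{q}$ that are not defined (i.e. those with $q>\ell$ or $q=0$) are omitted, together with the corresponding zero summand: for $p=1$ the first block row is omitted, and for $p=j$ the second block column is omitted.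
   Context: $0\in\mathbb{N}$. A $k$-graph is a countable category $\Lambda$ with a functor $d:\Lambda\to\mathbb{N}^k$ such that whenever $d(\lambda)=m+n$ there are unique $\mu,\nu\in\Lambda$ with $d(\mu)=m$, $d(\nu)=n$ and $\lambda=\mu\nu$. $\Lambda^0$ is its object set (identified with the identity morphisms), and $r,s$ are the range and source maps. $\Lambda$ is row-finite (resp. source-free) if $r^{-1}(v)\cap d^{-1}(n)$ is finite (resp. nonempty) for all $v\in\Lambda^0$, $n\in\mathbb{N}^k$. Let $e_1,\dots,e_k$ be the canonical generators of $\mathbb{N}^k$ and $\iota_j:\mathbb{N}^j\to\mathbb{N}^k$ the inclusion onto the first $j$ generators. For a monoid morphism $f:\mathbb{N}^\ell\to\mathbb{N}^k$, the pullback is the $\ell$-graph $f^*(\Lambda)=\{(\lambda,n): d(\lambda)=f(n)\}$ with $d(\lambda,n)=n$, $s(\lambda,n)=s(\lambda)$, $r(\lambda,n)=r(\lambda)$. Thus $\Lambda_j=\iota_j^*(\Lambda)$ has the same vertex set as $\Lambda$. For $1\le i\le k$, $M_i$ is the adjacency matrix of the $i$-th coordinate graph: the $\Lambda^0\times\Lambda^0$ matrix $M_i(v,w)=|\{\lambda: d(\lambda)=e_i,\ r(\lambda)=v,\ s(\lambda)=w\}|$. Put $\mathbb{Z}\Lambda^0=\bigoplus_{v\in\Lambda^0}\mathbb{Z}$; the co-adjacency matrix $B_i:=I-M_i^T$ is an endomorphism of $\mathbb{Z}\Lambda^0$. The matrices $M_i$, $B_i$ of $\Lambda_j$ ($i\le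 j$) are those of $\Lambda$. For $p\ge 1$, $N_{p,j}$ is the set of tuples $a=(a_1,\dots,a_p)\in\{1,\dots,j\}^p$ with $a_1<\cdots<a_p$ (empty if $p>j$), and $N_{0,j}=\{*\}$. For $a\in N_{p,j}$, $a^i\in N_{p-1,j}$ is $a$ with its $i$-th coordinate removed ($a^1=*$ if $p=1$). The Evans chain complex $\mathcal{D}^j$ of $\Lambda_j$ has $\mathcal{D}^j_p=\bigoplus_{a\in N_{p,j}}\mathbb{Z}\Lambda^0$ for $0\le p\le j$ and $\mathcal{D}^j_p=0$ otherwise, with differentials, for $1\le p\le j$, $$\partial^j_p\Big(\bigoplus_{a\in N_{p,j}}m_a\Big)=\bigoplus_{b\in N_{p-1,j}}\ \sum_{a\in N_{p,j}}\sum_{i=1}^p(-1)^{i+1}\delta_{b,a^i}B_{a_i}(m_a).$$ Decomposition: for $p\ge1$ let $N^+_{p,j}=\{a\in N_{p,j}:a_p=j\}$ and $N^-_{p,j}=N_{p,j}\setminus N^+_{p,j}$; put $N_{0,j}^+=\emptyset$, $N_{0,j}^-=N_{0,j}$. Deleting the last entry identifies $N^+_{p,j}$ with $N_{p-1,j-1}$, and $N^-_{p,j}$ is identified with $N_{p,j-1}$ by $a\mapsto a$. This gives $\mathcal{D}^j_p\cong\mathcal{D}^{j-1}_{p-1}\oplus\mathcal{D}^{j-1}_p$, where the first summand corresponds to $N^+_{p,j}$ and the second to $N^-_{p,j}$. *)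

theory Defs
  imports "HOL-Algebra.Free_Abelian_Groups"
begin

section \<open>Higher-rank graphs\<close>

text \<open>
  The monoid \<open>\<nat>\<^sup>k\<close> consists of the finitely supported functions
  \<open>n :: nat \<Rightarrow>\<^sub>0 nat\<close> with support in \<open>{1..k}\<close>. Thus
  \<open>\<nat>\<^sup>j \<subseteq> \<nat>\<^sup>k\<close> for \<open>j \<le> k\<close>, the \<open>i\<close>-th generator \<open>e\<^sub>i\<close> is
  \<open>Poly_Mapping.single i 1\<close>, and the inclusion \<open>\<iota>\<^sub>j\<close> onto the first \<open>j\<close>
  generators is the identity function.
\<close>

definition deg_monoid :: "nat \<Rightarrow> (nat \<Rightarrow>\<^sub>0 nat) set" where
  "deg_monoid k = {n. Poly_Mapping.keys n \<subseteq> {1..k}}"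

text \<open>Composition \<open>comp \<Lambda> \<mu> \<nu>\<close> is meaningful when \<open>src \<Lambda> \<mu> = rng \<Lambda> \<nu>\<close>.\<close>

record ('o, 'm) graded_cat =
  obj :: "'o set"
  mor :: "'m set"
  rng :: "'m \<Rightarrow> 'o"
  src :: "'m \<Rightarrow> 'o"
  ident :: "'o \<Rightarrow> 'm"
  comp :: "'m \<Rightarrow> 'm \<Rightarrow> 'm"
  deg :: "'m \<Rightarrow> (nat \<Rightarrow>\<^sub>0 nat)"

locale k_graph =
  fixes k :: nat and \<Lambda> :: "('o, 'm) graded_cat"
  assumes countable_mor: "countable (mor \<Lambda>)"
    and rng_obj: "l \<in> mor \<Lambda> \<Longrightarrow> rng \<Lambda> l \<in> obj \<Lambda>"
    and src_obj: "l \<in> mor \<Lambda> \<Longrightarrow> src \<Lambda> l \<in> obj \<Lambda>"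
    and ident_mor: "v \<in> obj \<Lambda> \<Longrightarrow> ident \<Lambda> v \<in> mor \<Lambda>"
    and rng_ident: "v \<in> obj \<Lambda> \<Longrightarrow> rng \<Lambda> (ident \<Lambda> v) = v"
    and src_ident: "v \<in> obj \<Lambda> \<Longrightarrow> src \<Lambda> (ident \<Lambda> v) = v"
    and comp_mor: "\<lbrakk>\<mu> \<in> mor \<Lambda>; \<nu> \<in> mor \<Lambda>; src \<Lambda> \<mu> = rng \<Lambda> \<nu>\<rbrakk> \<Longrightarrow> comp \<Lambda> \<mu> \<nu> \<in> mor \<Lambda>"
    and rng_comp: "\<lbrakk>\<mu> \<in> mor \<Lambda>; \<nu> \<in> mor \<Lambda>; src \<Lambda> \<mu> = rng \<Lambda> \<nu>\<rbrakk> \<Longrightarrow> rng \<Lambda> (comp \<Lambda> \<mu> \<nu>) = rng \<Lambda> \<mu>"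
    and src_comp: "\<lbrakk>\<mu> \<in> mor \<Lambda>; \<nu> \<in> mor \<Lambda>; src \<Lambda> \<mu> = rng \<Lambda> \<nu>\<rbrakk> \<Longrightarrow> src \<Lambda> (comp \<Lambda> \<mu> \<nu>) = src \<Lambda> \<nu>"
    and comp_assoc: "\<lbrakk>\<kappa> \<in> mor \<Lambda>; \<mu> \<in> mor \<Lambda>; \<nu> \<in> mor \<Lambda>; src \<Lambda> \<kappa> = rng \<Lambda> \<mu>; src \<Lambda> \<mu> = rng \<Lambda> \<nu>\<rbrakk>
      \<Longrightarrow> comp \<Lambda> (comp \<Lambda> \<kappa> \<mu>) \<nu> = comp \<Lambda> \<kappa> (comp \<Lambda> \<mu> \<nu>)"
    and ident_comp: "l \<in> mor \<Lambda> \<Longrightarrow> comp \<Lambda> (ident \<Lambda> (rng \<Lambda> l)) l = l"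
    and comp_ident: "l \<in> mor \<Lambda> \<Longrightarrow> comp \<Lambda> l (ident \<Lambda> (src \<Lambda> l)) = l"
    and deg_closed: "l \<in> mor \<Lambda> \<Longrightarrow> deg \<Lambda> l \<in> deg_monoid k"
    and deg_ident: "v \<in> obj \<Lambda> \<Longrightarrow> deg \<Lambda> (ident \<Lambda> v) = 0"
    and deg_comp: "\<lbrakk>\<mu> \<in> mor \<Lambda>; \<nu> \<in> mor \<Lambda>; src \<Lambda> \<mu> = rng \<Lambda> \<nu>\<rbrakk>
      \<Longrightarrow> deg \<Lambda> (comp \<Lambda> \<mu> \<nu>) = deg \<Lambda> \<mu> + deg \<Lambda> \<nu>"
    and factorization: "\<lbrakk>l \<in> mor \<Lambda>; m \<in> deg_monoid k; n \<in> deg_monoid k; deg \<Lambda> l = m + n\<rbrakk>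
      \<Longrightarrow> \<exists>!(\<mu>, \<nu>). \<mu> \<in> mor \<Lambda> \<and> \<nu> \<in> mor \<Lambda> \<and> src \<Lambda> \<mu> = rng \<Lambda> \<nu>
            \<and> deg \<Lambda> \<mu> = m \<and> deg \<Lambda> \<nu> = n \<and> l = comp \<Lambda> \<mu> \<nu>"

definition row_finite :: "nat \<Rightarrow> ('o, 'm) graded_cat \<Rightarrow> bool" where
  "row_finite k \<Lambda> \<longleftrightarrow>
    (\<forall>v\<in>obj \<Lambda>. \<forall>n\<in>deg_monoid k. finite {l \<in> mor \<Lambda>. rng \<Lambda> l = v \<and> deg \<Lambda> l = n})"

definition source_free :: "nat \<Rightarrow> ('o, 'm) graded_cat \<Rightarrow> bool" where
  "source_free k \<Lambda> \<longleftrightarrow>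
    (\<forall>v\<in>obj \<Lambda>. \<forall>n\<in>deg_monoid k. {l \<in> mor \<Lambda>. rng \<Lambda> l = v \<and> deg \<Lambda> l = n} \<noteq> {})"

definition pullback ::
  "nat \<Rightarrow> ((nat \<Rightarrow>\<^sub>0 nat) \<Rightarrow> (nat \<Rightarrow>\<^sub>0 nat)) \<Rightarrow> ('o, 'm) graded_cat \<Rightarrow> ('o, 'm \<times> (nat \<Rightarrow>\<^sub>0 nat)) graded_cat"
where
  "pullback q f \<Lambda> =
    \<lparr>obj = obj \<Lambda>,
     mor = {(l, n). l \<in> mor \<Lambda> \<and> n \<in> deg_monoid q \<and> deg \<Lambda> l = f n},
     rng = (\<lambda>(l, n). rng \<Lambda> l),
     src = (\<lambda>(l, n). src \<Lambda> l),
     ident = (\<lambda>v. (ident \<Lambda> v, 0)),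
     comp = (\<lambda>(l, m) (l', n). (comp \<Lambda> l l', m + n)),
     deg = (\<lambda>(l, n). n)\<rparr>"

text \<open>\<open>\<Lambda>\<^sub>j = \<iota>\<^sub>j\<^sup>*(\<Lambda>)\<close>; recall that \<open>\<iota>\<^sub>j\<close> is the identity function in this encoding.\<close>

definition subgraph :: "('o, 'm) graded_cat \<Rightarrow> nat \<Rightarrow> ('o, 'm \<times> (nat \<Rightarrow>\<^sub>0 nat)) graded_cat" where
  "subgraph \<Lambda> j = pullback j (\<lambda>n. n) \<Lambda>"


section \<open>Co-adjacency matrices\<close>

definition adjacency :: "('o, 'm) graded_cat \<Rightarrow> nat \<Rightarrow> 'o \<Rightarrow> 'o \<Rightarrow> int" where
  "adjacency \<Lambda> i v w =
    int (card {l \<in> mor \<Lambda>. deg \<Lambda> l = Poly_Mapping.single i 1 \<and> rng \<Lambda> l = v \<and> src \<Lambda> l = w})"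

definition coadjacency :: "('o, 'm) graded_cat \<Rightarrow> nat \<Rightarrow> 'o \<Rightarrow> 'o \<Rightarrow> int" where
  "coadjacency \<Lambda> i v w = (if v = w then 1 else 0) - adjacency \<Lambda> i w v"

text \<open>
  \<open>\<int>\<Lambda>\<^sup>0\<close> is \<open>free_Abelian_group (obj \<Lambda>)\<close>. The endomorphism \<open>B\<^sub>i\<close> multiplies a column
  vector by the matrix \<open>coadjacency \<Lambda> i\<close>; its values are finitely supported if \<open>\<Lambda>\<close> is
  row-finite, see \<open>lookup_coadj\<close> below.
\<close>

definition coadj :: "('o, 'm) graded_cat \<Rightarrow> nat \<Rightarrow> ('o \<Rightarrow>\<^sub>0 int) \<Rightarrow> ('o \<Rightarrow>\<^sub>0 int)" where
  "coadj \<Lambda> i m =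
    Abs_poly_mapping (\<lambda>v. \<Sum>w\<in>Poly_Mapping.keys m. coadjacency \<Lambda> i v w * Poly_Mapping.lookup m w)"


section \<open>The Evans chain complex\<close>

text \<open>
  \<open>N\<^sub>p\<^sub>,\<^sub>j\<close>: tuples are lists, so the entry \<open>a\<^sub>i\<close> is \<open>a ! (i - 1)\<close>, and the
  symbol \<open>*\<close> with \<open>N\<^sub>0\<^sub>,\<^sub>j = {*}\<close> is the empty list.
\<close>

definition tuples :: "nat \<Rightarrow> nat \<Rightarrow> nat list set" where
  "tuples p j = {a. length a = p \<and> set a \<subseteq> {1..j} \<and> sorted_wrt (<) a}"

definition omit :: "nat \<Rightarrow> nat list \<Rightarrow> nat list" where
  "omit i a = take (i - 1) a @ drop i a"

definition evans_group :: "('o, 'm) graded_cat \<Rightarrow> nat \<Rightarrow> nat \<Rightarrow> (nat list \<Rightarrow> ('o \<Rightarrow>\<^sub>0 int)) monoid" where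
  "evans_group \<Gamma> j p = sum_group (tuples p j) (\<lambda>_. free_Abelian_group (obj \<Gamma>))"

text \<open>The differential \<open>\<partial>\<^sub>p : \<D>\<^sub>p \<rightarrow> \<D>\<^sub>p\<^sub>-\<^sub>1\<close> of a \<open>j\<close>-graph \<open>\<Gamma>\<close>, for \<open>1 \<le> p \<le> j\<close>.\<close>

definition evans_diff ::
  "('o, 'm) graded_cat \<Rightarrow> nat \<Rightarrow> nat \<Rightarrow> (nat list \<Rightarrow> ('o \<Rightarrow>\<^sub>0 int)) \<Rightarrow> (nat list \<Rightarrow> ('o \<Rightarrow>\<^sub>0 int))"
where
  "evans_diff \<Gamma> j p m =
    (\<lambda>b\<in>tuples (p - 1) j. \<Sum>a\<in>tuples p j. \<Sum>i=1..p.
       frag_cmul ((-1) ^ (i + 1) * (if b = omit i a then 1 else 0)) (coadj \<Gamma> (a ! (i - 1)) (m a)))"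


section \<open>The decomposition\<close>

text \<open>\<open>N\<^sup>+\<^sub>p\<^sub>,\<^sub>j\<close> and \<open>N\<^sup>-\<^sub>p\<^sub>,\<^sub>j\<close>\<close>

definition tuples_plus :: "nat \<Rightarrow> nat \<Rightarrow> nat list set" where
  "tuples_plus p j = {a \<in> tuples p j. p \<ge> 1 \<and> last a = j}"

definition tuples_minus :: "nat \<Rightarrow> nat \<Rightarrow> nat list set" where
  "tuples_minus p j = tuples p j - tuples_plus p j"

text \<open>
  The components of \<open>m \<in> \<D>\<^sup>j\<^sub>p\<close> in \<open>\<D>\<^sup>j\<^sup>-\<^sup>1\<^sub>p\<^sub>-\<^sub>1\<close> (for \<open>p \<ge> 1\<close>) and in \<open>\<D>\<^sup>j\<^sup>-\<^sup>1\<^sub>p\<close>, i.e. the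
  restrictions of \<open>m\<close> to \<open>N\<^sup>+\<^sub>p\<^sub>,\<^sub>j\<close> and \<open>N\<^sup>-\<^sub>p\<^sub>,\<^sub>j\<close>, re-indexed along the inverse
  \<open>c \<mapsto> c @ [j]\<close> of deleting the last entry and along the identity.
\<close>

definition plus_part :: "nat \<Rightarrow> nat \<Rightarrow> (nat list \<Rightarrow> 'b) \<Rightarrow> (nat list \<Rightarrow> 'b)" where
  "plus_part j p m = (\<lambda>c\<in>tuples (p - 1) (j - 1). m (c @ [j]))"

definition minus_part :: "nat \<Rightarrow> nat \<Rightarrow> (nat list \<Rightarrow> 'b) \<Rightarrow> (nat list \<Rightarrow> 'b)" where
  "minus_part j p m = (\<lambda>c\<in>tuples p (j - 1). m c)"


section \<open>Basic facts justifying the definitions\<close>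

lemma deg_monoid_0 [simp]: "0 \<in> deg_monoid k"
  by (simp add: deg_monoid_def)

lemma deg_monoid_add: "m \<in> deg_monoid k \<Longrightarrow> n \<in> deg_monoid k \<Longrightarrow> m + n \<in> deg_monoid k"
  using Poly_Mapping.keys_add[of m n] by (auto simp: deg_monoid_def)

lemma deg_monoid_single [simp]: "i \<in> {1..k} \<Longrightarrow> Poly_Mapping.single i 1 \<in> deg_monoid k"
  by (simp add: deg_monoid_def)

lemma deg_monoid_mono: "j \<le> k \<Longrightarrow> deg_monoid j \<subseteq> deg_monoid k"
  by (auto simp: deg_monoid_def)

lemma k_graph_pullback:
  assumes "k_graph k \<Lambda>"
    and f: "\<And>n. n \<in> deg_monoid q \<Longrightarrow> f n \<in> deg_monoid k" "f 0 = 0"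
      "\<And>m n. m \<in> deg_monoid q \<Longrightarrow> n \<in> deg_monoid q \<Longrightarrow> f (m + n) = f m + f n"
  shows "k_graph q (pullback q f \<Lambda>)"
proof -
  interpret k_graph k \<Lambda> by fact
  have cm: "countable (deg_monoid q)"
  proof -
    have "inj_on (\<lambda>n. map (Poly_Mapping.lookup n) [1..<Suc q]) (deg_monoid q)"
    proof (rule inj_onI)
      fix m n :: "nat \<Rightarrow>\<^sub>0 nat"
      assume mn: "m \<in> deg_monoid q" "n \<in> deg_monoid q"
        and eq: "map (Poly_Mapping.lookup m) [1..<Suc q] = map (Poly_Mapping.lookup n) [1..<Suc q]"
      have eq': "\<forall>i\<in>set [1..<Suc q]. Poly_Mapping.lookup m i = Poly_Mapping.lookup n i"
        using eq by (simp only: map_eq_conv)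
      show "m = n"
      proof (rule poly_mapping_eqI)
        fix i
        show "Poly_Mapping.lookup m i = Poly_Mapping.lookup n i"
        proof (cases "i \<in> {1..q}")
          case True
          then have "i \<in> set [1..<Suc q]" by auto
          then show ?thesis by (rule bspec[OF eq'])
        next
          case False
          then have "i \<notin> Poly_Mapping.keys m" "i \<notin> Poly_Mapping.keys n"
            using mn by (auto simp: deg_monoid_def)
          then show ?thesis by (simp add: in_keys_iff)
        qed
      qed
    qed
    then show ?thesis by (rule countable_image_inj_on[OF countableI_type])
  qed
  show ?thesis
  proof
    show "countable (mor (pullback q f \<Lambda>))"
      by (rule countable_subset[of _ "mor \<Lambda> \<times> deg_monoid q"])
         (auto simp: pullback_def intro: countable_SIGMA countable_mor cm)
  next
    fix x m n
    assume x: "x \<in> mor (pullback q f \<Lambda>)" and m: "m \<in> deg_monoid q" and n: "n \<in> deg_monoid q"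
      and d: "deg (pullback q f \<Lambda>) x = m + n"
    obtain l where l: "x = (l, m + n)" "l \<in> mor \<Lambda>" "deg \<Lambda> l = f m + f n"
      using x d m n f(3) by (cases x) (auto simp: pullback_def)
    define P where "P = (\<lambda>(\<mu>, \<nu>). \<mu> \<in> mor \<Lambda> \<and> \<nu> \<in> mor \<Lambda> \<and> src \<Lambda> \<mu> = rng \<Lambda> \<nu>
            \<and> deg \<Lambda> \<mu> = f m \<and> deg \<Lambda> \<nu> = f n \<and> l = comp \<Lambda> \<mu> \<nu>)"
    have "\<exists>!z. P z"
      unfolding P_def by (rule factorization) (use l f m n in auto)
    then obtain \<mu> \<nu> where P: "P (\<mu>, \<nu>)" and uniq: "\<And>z. P z \<Longrightarrow> z = (\<mu>, \<nu>)"
      by (metis surj_pair)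
    show "\<exists>!(\<mu>, \<nu>). \<mu> \<in> mor (pullback q f \<Lambda>) \<and> \<nu> \<in> mor (pullback q f \<Lambda>)
            \<and> src (pullback q f \<Lambda>) \<mu> = rng (pullback q f \<Lambda>) \<nu>
            \<and> deg (pullback q f \<Lambda>) \<mu> = m \<and> deg (pullback q f \<Lambda>) \<nu> = n
            \<and> x = comp (pullback q f \<Lambda>) \<mu> \<nu>"
    proof (rule ex1I[of _ "((\<mu>, m), (\<nu>, n))"])
      fix z
      assume z: "case z of (\<mu>, \<nu>) \<Rightarrow> \<mu> \<in> mor (pullback q f \<Lambda>) \<and> \<nu> \<in> mor (pullback q f \<Lambda>)
            \<and> src (pullback q f \<Lambda>) \<mu> = rng (pullback q f \<Lambda>) \<nu>
            \<and> deg (pullback q f \<Lambda>) \<mu> = m \<and> deg (pullback q f \<Lambda>) \<nu> = n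
            \<and> x = comp (pullback q f \<Lambda>) \<mu> \<nu>"
      obtain \<mu>' m' \<nu>' n' where zz: "z = ((\<mu>', m'), (\<nu>', n'))"
        by (metis surj_pair)
      have eqs: "m' = m" "n' = n" "\<mu>' \<in> mor \<Lambda>" "\<nu>' \<in> mor \<Lambda>" "src \<Lambda> \<mu>' = rng \<Lambda> \<nu>'"
        "deg \<Lambda> \<mu>' = f m'" "deg \<Lambda> \<nu>' = f n'" "l = comp \<Lambda> \<mu>' \<nu>'"
        using z unfolding zz l(1) pullback_def by simp_all
      then have "P (\<mu>', \<nu>')" unfolding P_def by simp
      then have "(\<mu>', \<nu>') = (\<mu>, \<nu>)" by (rule uniq)
      then show "z = ((\<mu>, m), (\<nu>, n))" using zz eqs(1,2) by simp
    qed (use P l m n in \<open>auto simp: P_def pullback_def\<close>)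
  qed (auto simp: pullback_def rng_obj src_obj ident_mor rng_ident src_ident comp_mor rng_comp
        src_comp comp_assoc ident_comp comp_ident deg_ident deg_comp f deg_monoid_add add.assoc)
qed

lemma obj_subgraph [simp]: "obj (subgraph \<Lambda> j) = obj \<Lambda>"
  by (simp add: subgraph_def pullback_def)

lemma k_graph_subgraph:
  assumes "k_graph k \<Lambda>" "j \<le> k"
  shows "k_graph j (subgraph \<Lambda> j)"
  unfolding subgraph_def
  by (rule k_graph_pullback[OF assms(1)]) (use deg_monoid_mono[OF assms(2)] in auto)

lemma fibre_subgraph:
  assumes "n \<in> deg_monoid j"
  shows "{l \<in> mor (subgraph \<Lambda> j). deg (subgraph \<Lambda> j) l = n \<and> Q (rng (subgraph \<Lambda> j) l) (src (subgraph \<Lambda> j) l)}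
    = (\<lambda>l. (l, n)) ` {l \<in> mor \<Lambda>. deg \<Lambda> l = n \<and> Q (rng \<Lambda> l) (src \<Lambda> l)}"
  using assms by (auto simp: subgraph_def pullback_def)

lemma row_finite_subgraph:
  assumes "row_finite k \<Lambda>" "j \<le> k"
  shows "row_finite j (subgraph \<Lambda> j)"
  unfolding row_finite_def
proof (intro ballI)
  fix v n assume v: "v \<in> obj (subgraph \<Lambda> j)" and n: "n \<in> deg_monoid j"
  have "finite {l \<in> mor \<Lambda>. deg \<Lambda> l = n \<and> rng \<Lambda> l = v}"
    using assms v n deg_monoid_mono[OF assms(2)] by (auto simp: row_finite_def conj_commute)
  then show "finite {l \<in> mor (subgraph \<Lambda> j). rng (subgraph \<Lambda> j) l = v \<and> deg (subgraph \<Lambda> j) l = n}"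
    using fibre_subgraph[OF n, of \<Lambda> "\<lambda>r s. r = v"] by (simp add: conj_commute)
qed

lemma source_free_subgraph:
  assumes "source_free k \<Lambda>" "j \<le> k"
  shows "source_free j (subgraph \<Lambda> j)"
  unfolding source_free_def
proof (intro ballI)
  fix v n assume v: "v \<in> obj (subgraph \<Lambda> j)" and n: "n \<in> deg_monoid j"
  have "{l \<in> mor \<Lambda>. rng \<Lambda> l = v \<and> deg \<Lambda> l = n} \<noteq> {}"
    using assms v n deg_monoid_mono[OF assms(2)] unfolding source_free_def obj_subgraph by blast
  then obtain l where "l \<in> mor \<Lambda>" "rng \<Lambda> l = v" "deg \<Lambda> l = n" by blast
  then have "(l, n) \<in> {l \<in> mor (subgraph \<Lambda> j). rng (subgraph \<Lambda> j) l = v \<and> deg (subgraph \<Lambda> j) l = n}"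
    using n by (auto simp: subgraph_def pullback_def)
  then show "{l \<in> mor (subgraph \<Lambda> j). rng (subgraph \<Lambda> j) l = v \<and> deg (subgraph \<Lambda> j) l = n} \<noteq> {}"
    by blast
qed

lemma adjacency_subgraph:
  assumes "i \<in> {1..j}"
  shows "adjacency (subgraph \<Lambda> j) i = adjacency \<Lambda> i"
proof (intro ext)
  fix v w
  show "adjacency (subgraph \<Lambda> j) i v w = adjacency \<Lambda> i v w"
    unfolding adjacency_def
    by (subst fibre_subgraph[OF deg_monoid_single[OF assms], of _ "\<lambda>r s. r = v \<and> s = w"])
       (simp add: card_image inj_on_def)
qed

lemma coadj_subgraph:
  assumes "i \<in> {1..j}"
  shows "coadj (subgraph \<Lambda> j) i = coadj \<Lambda> i"
  by (intro ext) (simp add: coadj_def coadjacency_def adjacency_subgraph[OF assms])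

lemma lookup_coadj:
  assumes "row_finite k \<Lambda>" "i \<in> {1..k}" "Poly_Mapping.keys m \<subseteq> obj \<Lambda>"
  shows "Poly_Mapping.lookup (coadj \<Lambda> i m) v =
    (\<Sum>w\<in>Poly_Mapping.keys m. coadjacency \<Lambda> i v w * Poly_Mapping.lookup m w)"
proof -
  let ?E = "\<lambda>w. {l \<in> mor \<Lambda>. rng \<Lambda> l = w \<and> deg \<Lambda> l = Poly_Mapping.single i 1}"
  let ?S = "Poly_Mapping.keys m \<union> (\<Union>w\<in>Poly_Mapping.keys m. src \<Lambda> ` ?E w)"
  have "finite (?E w)" if "w \<in> Poly_Mapping.keys m" for w
    using assms that deg_monoid_single[OF assms(2)] unfolding row_finite_def by blast
  then have "finite ?S" by auto
  moreover have "{v. (\<Sum>w\<in>Poly_Mapping.keys m. coadjacency \<Lambda> i v w * Poly_Mapping.lookup m w) \<noteq> 0} \<subseteq> ?S"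
  proof
    fix v assume "v \<in> {v. (\<Sum>w\<in>Poly_Mapping.keys m. coadjacency \<Lambda> i v w * Poly_Mapping.lookup m w) \<noteq> 0}"
    then obtain w where w: "w \<in> Poly_Mapping.keys m" "coadjacency \<Lambda> i v w \<noteq> 0"
      by (smt (verit) mem_Collect_eq mult_eq_0_iff sum.neutral)
    show "v \<in> ?S"
    proof (cases "v = w")
      case False
      then have "adjacency \<Lambda> i w v \<noteq> 0" using w by (simp add: coadjacency_def)
      then have "{l \<in> mor \<Lambda>. deg \<Lambda> l = Poly_Mapping.single i 1 \<and> rng \<Lambda> l = w \<and> src \<Lambda> l = v} \<noteq> {}"
        unfolding adjacency_def by (metis card.empty of_nat_0)
      then show ?thesis using w by blast
    qed (use w in simp)
  qed
  ultimately have "finite {v. (\<Sum>w\<in>Poly_Mapping.keys m. coadjacency \<Lambda> i v w * Poly_Mapping.lookup m w) \<noteq> 0}"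
    by (rule finite_subset[rotated])
  then show ?thesis by (simp add: coadj_def)
qed

lemma coadj_hom:
  assumes "k_graph k \<Lambda>" "row_finite k \<Lambda>" "i \<in> {1..k}"
  shows "coadj \<Lambda> i \<in> hom (free_Abelian_group (obj \<Lambda>)) (free_Abelian_group (obj \<Lambda>))"
proof (rule homI)
  interpret k_graph k \<Lambda> by fact
  fix x assume x: "x \<in> carrier (free_Abelian_group (obj \<Lambda>))"
  have "coadjacency \<Lambda> i v w = 0" if "v \<notin> obj \<Lambda>" "w \<in> obj \<Lambda>" for v w
  proof -
    have "{l \<in> mor \<Lambda>. deg \<Lambda> l = Poly_Mapping.single i 1 \<and> rng \<Lambda> l = w \<and> src \<Lambda> l = v} = {}"
      using that src_obj by auto
    then have "adjacency \<Lambda> i w v = 0" unfolding adjacency_def by (metis card.empty of_nat_0)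
    then show ?thesis using that by (auto simp: coadjacency_def)
  qed
  then have "Poly_Mapping.lookup (coadj \<Lambda> i x) v = 0" if "v \<notin> obj \<Lambda>" for v
    using x that by (auto simp: lookup_coadj[OF assms(2,3)] intro!: sum.neutral)
  then show "coadj \<Lambda> i x \<in> carrier (free_Abelian_group (obj \<Lambda>))"
    by (auto simp: in_keys_iff)
next
  fix x y assume xy: "x \<in> carrier (free_Abelian_group (obj \<Lambda>))" "y \<in> carrier (free_Abelian_group (obj \<Lambda>))"
  let ?K = "Poly_Mapping.keys x \<union> Poly_Mapping.keys y"
  have ext: "Poly_Mapping.lookup (coadj \<Lambda> i m) v = (\<Sum>w\<in>?K. coadjacency \<Lambda> i v w * Poly_Mapping.lookup m w)"
    if "Poly_Mapping.keys m \<subseteq> ?K" for m v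
  proof -
    have "Poly_Mapping.keys m \<subseteq> obj \<Lambda>" using that xy by auto
    from lookup_coadj[OF assms(2,3) this] show ?thesis
      by (simp, intro sum.mono_neutral_left) (use that in \<open>auto simp: in_keys_iff\<close>)
  qed
  have "coadj \<Lambda> i (x + y) = coadj \<Lambda> i x + coadj \<Lambda> i y"
    by (rule poly_mapping_eqI)
       (simp add: ext keys_add lookup_add sum.distrib distrib_left)
  then show "coadj \<Lambda> i (x \<otimes>\<^bsub>free_Abelian_group (obj \<Lambda>)\<^esub> y)
      = coadj \<Lambda> i x \<otimes>\<^bsub>free_Abelian_group (obj \<Lambda>)\<^esub> coadj \<Lambda> i y"
    by simp
qed

lemma finite_tuples [simp]: "finite (tuples p j)"
  by (rule finite_subset[OF _ finite_lists_length_eq[of "{1..j}" p]]) (auto simp: tuples_def)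

lemma tuples_0 [simp]: "tuples 0 j = {[]}"
  by (auto simp: tuples_def)

lemma tuples_empty:
  assumes "p > j" shows "tuples p j = {}"
proof -
  have "length a \<le> j" if "set a \<subseteq> {1..j}" "sorted_wrt (<) a" for a
  proof -
    have "length a = card (set a)" using that strict_sorted_iff distinct_card by metis
    also have "\<dots> \<le> card {1..j}" using that by (intro card_mono) auto
    finally show ?thesis by simp
  qed
  then show ?thesis using assms by (force simp: tuples_def)
qed

lemma carrier_evans_group:
  "carrier (evans_group \<Gamma> j p) = (\<Pi>\<^sub>E a\<in>tuples p j. carrier (free_Abelian_group (obj \<Gamma>)))"
  by (simp add: evans_group_def carrier_sum_group)

lemma mult_evans_group: "x \<otimes>\<^bsub>evans_group \<Gamma> j p\<^esub> y = (\<lambda>a\<in>tuples p j. x a + y a)"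
  by (simp add: evans_group_def)

lemma evans_diff_hom:
  assumes "k_graph j \<Gamma>" "row_finite j \<Gamma>" "1 \<le> p" "p \<le> j"
  shows "evans_diff \<Gamma> j p \<in> hom (evans_group \<Gamma> j p) (evans_group \<Gamma> j (p - 1))"
proof (rule homI)
  have B: "coadj \<Gamma> (a ! (i - 1)) \<in> hom (free_Abelian_group (obj \<Gamma>)) (free_Abelian_group (obj \<Gamma>))"
    if "a \<in> tuples p j" "i \<in> {1..p}" for a i
  proof (rule coadj_hom[OF assms(1,2)])
    have "a ! (i - 1) \<in> set a" using that by (intro nth_mem) (auto simp: tuples_def)
    then show "a ! (i - 1) \<in> {1..j}" using that by (auto simp: tuples_def)
  qed
  fix x assume x: "x \<in> carrier (evans_group \<Gamma> j p)"
  have "frag_cmul c (coadj \<Gamma> (a ! (i - 1)) (x a)) \<in> carrier (free_Abelian_group (obj \<Gamma>))"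
    if "a \<in> tuples p j" "i \<in> {1..p}" for a i c
    using hom_in_carrier[OF B[OF that], of "x a"] x that keys_cmul
    unfolding carrier_evans_group PiE_iff carrier_free_Abelian_group_iff by blast
  then show "evans_diff \<Gamma> j p x \<in> carrier (evans_group \<Gamma> j (p - 1))"
    unfolding carrier_evans_group evans_diff_def
    by (auto intro!: sum_closed_free_Abelian_group simp del: carrier_free_Abelian_group_iff)
  fix y assume y: "y \<in> carrier (evans_group \<Gamma> j p)"
  have add: "coadj \<Gamma> (a ! (i - 1)) (x a + y a) = coadj \<Gamma> (a ! (i - 1)) (x a) + coadj \<Gamma> (a ! (i - 1)) (y a)"
    if "a \<in> tuples p j" "i \<in> {1..p}" for a i
    using hom_mult[OF B[OF that], of "x a" "y a"] x y that unfolding carrier_evans_group PiE_iff by simp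
  have scaled: "frag_cmul s (coadj \<Gamma> (a ! (i - 1)) ((\<lambda>a\<in>tuples p j. x a + y a) a))
      = frag_cmul s (coadj \<Gamma> (a ! (i - 1)) (x a)) + frag_cmul s (coadj \<Gamma> (a ! (i - 1)) (y a))"
    if "a \<in> tuples p j" "i \<in> {1..p}" for a i s
    by (simp only: restrict_apply' that add[OF that] frag_cmul_distrib2)
  show "evans_diff \<Gamma> j p (x \<otimes>\<^bsub>evans_group \<Gamma> j p\<^esub> y)
      = evans_diff \<Gamma> j p x \<otimes>\<^bsub>evans_group \<Gamma> j (p - 1)\<^esub> evans_diff \<Gamma> j p y"
    unfolding mult_evans_group evans_diff_def
    by (rule restrict_ext)
       (simp only: restrict_apply' sum.distrib[symmetric], intro sum.cong refl scaled)
qed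

lemma tuples_minus_eq:
  assumes "1 \<le> j" shows "tuples_minus p j = tuples p (j - 1)"
proof (cases "p = 0")
  case False
  show ?thesis
  proof (intro subset_antisym subsetI)
    fix a assume a: "a \<in> tuples_minus p j"
    then have a': "length a = p" "set a \<subseteq> {1..j}" "sorted_wrt (<) a" "last a \<noteq> j"
      using False unfolding tuples_minus_def tuples_plus_def tuples_def by auto
    have "a \<noteq> []" using False a'(1) by auto
    then obtain c z where c: "a = c @ [z]" by (metis rev_exhaust)
    have z: "z < j" using a' c by (simp add: nat_less_le)
    have "set a \<subseteq> {1..j - 1}"
    proof
      fix x assume "x \<in> set a"
      then have "x \<le> z" "1 \<le> x" using a' c by (auto simp: sorted_wrt_append)
      then show "x \<in> {1..j - 1}" using z by simp
    qed
    then show "a \<in> tuples p (j - 1)" using a' unfolding tuples_def by blast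
  next
    fix a assume a: "a \<in> tuples p (j - 1)"
    then have a': "length a = p" "set a \<subseteq> {1..j - 1}" "sorted_wrt (<) a"
      unfolding tuples_def by auto
    have "a \<noteq> []" using False a'(1) by auto
    then have "last a \<in> {1..j - 1}" using a'(2) last_in_set by blast
    then have "last a \<noteq> j" using assms by auto
    moreover have "set a \<subseteq> {1..j}" using a'(2) by fastforce
    ultimately show "a \<in> tuples_minus p j"
      using a' unfolding tuples_minus_def tuples_plus_def tuples_def by blast
  qed
qed (simp add: tuples_minus_def tuples_plus_def)

lemma tuples_append_iff:
  assumes "1 \<le> j" "1 \<le> p"
  shows "c @ [j] \<in> tuples p j \<longleftrightarrow> c \<in> tuples (p - 1) (j - 1)"
proof -
  have "(\<forall>x\<in>set c. 1 \<le> x \<and> x \<le> j \<and> x < j) \<longleftrightarrow> (\<forall>x\<in>set c. 1 \<le> x \<and> x \<le> j - 1)"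
    using assms by (intro ball_cong refl) linarith
  moreover have "Suc (length c) = p \<longleftrightarrow> length c = p - 1"
    using assms by linarith
  ultimately show ?thesis
    using assms unfolding tuples_def by (auto simp: sorted_wrt_append subset_iff)
qed

lemma tuples_plus_eq:
  assumes "1 \<le> j" "1 \<le> p"
  shows "tuples_plus p j = (\<lambda>c. c @ [j]) ` tuples (p - 1) (j - 1)"
proof (intro subset_antisym subsetI)
  fix a assume a: "a \<in> tuples_plus p j"
  then have "a \<noteq> []" "last a = j" using assms unfolding tuples_plus_def tuples_def by auto
  then have "a = butlast a @ [j]" by (metis append_butlast_last_id)
  moreover from this have "butlast a \<in> tuples (p - 1) (j - 1)"
    using a tuples_append_iff[OF assms, of "butlast a"] unfolding tuples_plus_def by simp
  ultimately show "a \<in> (\<lambda>c. c @ [j]) ` tuples (p - 1) (j - 1)" by blast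
next
  fix a assume "a \<in> (\<lambda>c. c @ [j]) ` tuples (p - 1) (j - 1)"
  then show "a \<in> tuples_plus p j"
    using assms tuples_append_iff[OF assms] unfolding tuples_plus_def by auto
qed

lemma bij_betw_butlast_tuples_plus:
  assumes "1 \<le> j" "1 \<le> p"
  shows "bij_betw butlast (tuples_plus p j) (tuples (p - 1) (j - 1))"
  by (rule bij_betw_byWitness[of _ "\<lambda>c. c @ [j]"]) (auto simp: tuples_plus_eq[OF assms])

lemma tuples_split:
  assumes "1 \<le> j" "1 \<le> p"
  shows "tuples p j = (\<lambda>c. c @ [j]) ` tuples (p - 1) (j - 1) \<union> tuples p (j - 1)"
    "c @ [j] \<notin> tuples p (j - 1)"
proof -
  show "tuples p j = (\<lambda>c. c @ [j]) ` tuples (p - 1) (j - 1) \<union> tuples p (j - 1)"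
    using tuples_plus_eq[OF assms] tuples_minus_eq[OF assms(1), of p]
    unfolding tuples_minus_def tuples_plus_def by blast
  show "c @ [j] \<notin> tuples p (j - 1)" using assms by (auto simp: tuples_def)
qed

lemma decomposition_iso:
  assumes "1 \<le> j" "1 \<le> p"
  shows "(\<lambda>m. (plus_part j p m, minus_part j p m)) \<in>
    iso (evans_group (subgraph \<Lambda> j) j p)
        (evans_group (subgraph \<Lambda> (j - 1)) (j - 1) (p - 1) \<times>\<times> evans_group (subgraph \<Lambda> (j - 1)) (j - 1) p)"
    (is "?f \<in> iso ?G (?H \<times>\<times> ?K)")
proof (rule isoI)
  have mem: "c @ [j] \<in> tuples p j" if "c \<in> tuples (p - 1) (j - 1)" for c
    using that by (simp add: tuples_append_iff[OF assms])
  have mem': "c \<in> tuples p j" if "c \<in> tuples p (j - 1)" for c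
    using that by (simp add: tuples_split(1)[OF assms])
  have closed: "?f x \<in> carrier (?H \<times>\<times> ?K)" if "x \<in> carrier ?G" for x
    using that mem mem'
    by (auto simp: carrier_evans_group plus_part_def minus_part_def PiE_iff simp del: carrier_free_Abelian_group_iff)
  show "?f \<in> hom ?G (?H \<times>\<times> ?K)"
    by (rule homI[OF closed])
       (auto simp: mult_evans_group plus_part_def minus_part_def mem mem' intro!: restrict_ext)
  let ?g = "\<lambda>(x, y). (\<lambda>a\<in>tuples p j. if a \<in> tuples p (j - 1) then y a else x (butlast a))"
  show "bij_betw ?f (carrier ?G) (carrier (?H \<times>\<times> ?K))"
  proof (rule bij_betw_byWitness[of _ ?g])
    show "\<forall>m\<in>carrier ?G. ?g (?f m) = m"
    proof
      fix m assume m: "m \<in> carrier ?G"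
      show "?g (?f m) = m"
      proof
        fix a
        show "?g (?f m) a = m a"
        proof (cases "a \<in> tuples p j")
          case True
          then show ?thesis
            using tuples_split[OF assms] by (auto simp: plus_part_def minus_part_def)
        next
          case False
          then show ?thesis using m by (auto simp: carrier_evans_group PiE_iff extensional_def)
        qed
      qed
    qed
    show "\<forall>z\<in>carrier (?H \<times>\<times> ?K). ?f (?g z) = z"
    proof
      fix z assume z: "z \<in> carrier (?H \<times>\<times> ?K)"
      obtain x y where xy: "z = (x, y)" by (cases z)
      have "x \<in> extensional (tuples (p - 1) (j - 1))" "y \<in> extensional (tuples p (j - 1))"
        using z xy by (auto simp: carrier_evans_group PiE_iff)
      then have "plus_part j p (?g z) = x" "minus_part j p (?g z) = y"
        unfolding xy plus_part_def minus_part_def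
        using mem mem' tuples_split(2)[OF assms]
        by (auto simp: fun_eq_iff extensional_def simp del: One_nat_def) metis
      then show "?f (?g z) = z" by (simp add: xy)
    qed
    show "?f ` carrier ?G \<subseteq> carrier (?H \<times>\<times> ?K)" using closed by blast
    show "?g ` carrier (?H \<times>\<times> ?K) \<subseteq> carrier ?G"
      by (auto simp: carrier_evans_group tuples_split(1)[OF assms] tuples_split(2)[OF assms] PiE_iff
          simp del: carrier_free_Abelian_group_iff split: if_splits)
  qed
qed

lemma decomposition_iso_0:
  shows "minus_part j 0 \<in>
    iso (evans_group (subgraph \<Lambda> j) j 0) (evans_group (subgraph \<Lambda> (j - 1)) (j - 1) 0)"
proof -
  have eq: "evans_group (subgraph \<Lambda> j) j 0 = evans_group (subgraph \<Lambda> (j - 1)) (j - 1) 0"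
    by (simp add: evans_group_def)
  have "minus_part j 0 m = m" if "m \<in> carrier (evans_group (subgraph \<Lambda> j) j 0)" for m
    using that by (auto simp: minus_part_def carrier_evans_group PiE_iff fun_eq_iff extensional_def)
  then have "\<forall>m\<in>carrier (evans_group (subgraph \<Lambda> (j - 1)) (j - 1) 0). minus_part j 0 m = m"
    unfolding eq by blast
  then show ?thesis
    unfolding eq iso_def hom_def
    by (auto simp: Pi_iff evans_group_def carrier_sum_group PiE_iff bij_betw_def inj_on_def
        minus_part_def)
qed

end

theory Submission
  imports Defs
begin

text \<open>
  The differential is a matrix indexed by \<open>N\<^sub>p\<^sub>-\<^sub>1\<^sub>,\<^sub>j \<times> N\<^sub>p\<^sub>,\<^sub>j\<close>. Its entry at \<open>(b, a)\<close> is a signed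
  endomorphism \<open>B\<^sub>l\<close> if \<open>b\<close> arises from \<open>a\<close> by deleting one entry \<open>l\<close>, and it is zero otherwise.
  The four blocks record which of \<open>a\<close> and \<open>b\<close> end in \<open>j\<close>. The entry \<open>j\<close> is the maximum of
  \<open>{1..j}\<close>, so it can only occur at the end, and this determines every block:

  \<^item> If neither tuple ends in \<open>j\<close>, the entry is literally one of the differential of \<open>\<Lambda>\<^sub>j\<^sub>-\<^sub>1\<close>.
  \<^item> If both do, \<open>a = c @ [j]\<close> and \<open>b = b' @ [j]\<close>, the deleted entry lies in \<open>c\<close>. Appending \<open>j\<close>
    at the end moves no other position, so all signs are those for \<open>c\<close> and \<open>b'\<close>
    (\<open>boundary_entry_snoc_snoc\<close>).
  \<^item> If only \<open>a = c @ [j]\<close> does, the deleted entry is the final \<open>j\<close>, in position \<open>p\<close>. Hence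
    \<open>b = c\<close>, which gives a block diagonal operator with \<open>(-1)\<^sup>p\<^sup>+\<^sup>1 B\<^sub>j\<close> on the diagonal
    (\<open>boundary_entry_snoc\<close>).
  \<^item> If only \<open>b\<close> does, the entry vanishes, as deletion creates no new entries
    (\<open>boundary_entry_eq_0\<close>).

  The matrices of \<open>\<Lambda>\<^sub>j\<close> and \<open>\<Lambda>\<^sub>j\<^sub>-\<^sub>1\<close> agree with those of \<open>\<Lambda>\<close>, so both differentials can be
  written with the same family \<open>B\<close> (\<open>evans_diff_subgraph\<close>). For \<open>p = j\<close> the index set
  \<open>N\<^sub>p\<^sub>,\<^sub>j\<^sub>-\<^sub>1\<close> is empty, so that the second block column contributes an empty sum.
\<close>

lemma omit_snoc:
  assumes "i \<in> {1..length c}"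
  shows "omit i (c @ [j]) = omit i c @ [j]"
  using assms by (auto simp: omit_def)

lemma omit_last: "omit (Suc (length c)) (c @ [j]) = c"
  by (simp add: omit_def)

lemma set_omit_subset: "set (omit i a) \<subseteq> set a"
  using set_take_subset[of "i - 1" a] set_drop_subset[of i a] by (auto simp: omit_def)

lemma notin_set_tuples:
  assumes "1 \<le> j" "a \<in> tuples p (j - 1)"
  shows "j \<notin> set a"
  using assms by (auto simp: tuples_def)

text \<open>
  The \<open>(b, a)\<close> entry of the matrix of the differential, for a family \<open>B\<close> of operators and applied to
  the vector \<open>x\<close>. If the entries of \<open>a\<close> are distinct, as they are in tuples, then at most one position
  \<open>i\<close> satisfies \<open>b = omit i a\<close>; summing over all positions avoids having to choose it.
\<close>

definition boundary_entry ::
  "(nat \<Rightarrow> 'b \<Rightarrow> ('o \<Rightarrow>\<^sub>0 int)) \<Rightarrow> nat list \<Rightarrow> nat list \<Rightarrow> 'b \<Rightarrow> ('o \<Rightarrow>\<^sub>0 int)"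
where
  "boundary_entry B b a x =
    (\<Sum>i=1..length a. frag_cmul ((-1) ^ (i + 1) * (if b = omit i a then 1 else 0)) (B (a ! (i - 1)) x))"

lemma boundary_entry_eq_0:
  assumes "\<not> set b \<subseteq> set a"
  shows "boundary_entry B b a x = 0"
proof -
  have "b \<noteq> omit i a" for i
    using assms set_omit_subset[of i a] by auto
  then show ?thesis by (simp add: boundary_entry_def)
qed

text \<open>
  Deleting from \<open>c @ [j]\<close> means deleting from \<open>c\<close> or deleting the final \<open>j\<close>. The latter position is
  \<open>length c + 1\<close>, which carries the sign \<open>(-1) ^ (length c + 2) = (-1) ^ length c\<close>.
\<close>

lemma boundary_entry_split_last:
  "boundary_entry B b (c @ [j]) x =
    (\<Sum>i=1..length c. frag_cmul ((-1) ^ (i + 1) * (if b = omit i c @ [j] then 1 else 0)) (B (c ! (i - 1)) x))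
    + frag_cmul ((-1) ^ length c * (if b = c then 1 else 0)) (B j x)"
proof -
  have init: "(\<Sum>i=1..length c. frag_cmul ((-1) ^ (i + 1) * (if b = omit i (c @ [j]) then 1 else 0))
          (B ((c @ [j]) ! (i - 1)) x))
      = (\<Sum>i=1..length c. frag_cmul ((-1) ^ (i + 1) * (if b = omit i c @ [j] then 1 else 0))
          (B (c ! (i - 1)) x))"
  proof (rule sum.cong[OF refl])
    fix i assume i: "i \<in> {1..length c}"
    then have "(c @ [j]) ! (i - 1) = c ! (i - 1)"
      by (auto simp: nth_append)
    then show "frag_cmul ((-1) ^ (i + 1) * (if b = omit i (c @ [j]) then 1 else 0))
          (B ((c @ [j]) ! (i - 1)) x)
        = frag_cmul ((-1) ^ (i + 1) * (if b = omit i c @ [j] then 1 else 0)) (B (c ! (i - 1)) x)"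
      by (simp only: omit_snoc[OF i])
  qed
  have "boundary_entry B b (c @ [j]) x =
      (\<Sum>i=1..length c. frag_cmul ((-1) ^ (i + 1) * (if b = omit i (c @ [j]) then 1 else 0))
          (B ((c @ [j]) ! (i - 1)) x))
      + frag_cmul ((-1) ^ length c * (if b = c then 1 else 0)) (B j x)"
    by (simp add: boundary_entry_def omit_last)
  then show ?thesis by (simp only: init)
qed

lemma boundary_entry_snoc_snoc:
  assumes "j \<notin> set c"
  shows "boundary_entry B (b @ [j]) (c @ [j]) x = boundary_entry B b c x"
proof -
  have "b @ [j] \<noteq> c" using assms by auto
  then show ?thesis
    unfolding boundary_entry_split_last by (simp add: boundary_entry_def)
qed

lemma boundary_entry_snoc:
  assumes "j \<notin> set b"
  shows "boundary_entry B b (c @ [j]) x = (if c = b then frag_cmul ((-1) ^ length c) (B j x) else 0)"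
proof -
  have "b \<noteq> omit i c @ [j]" for i using assms by auto
  then show ?thesis
    by (auto simp: boundary_entry_split_last)
qed

text \<open>
  Writing the differential with the matrices of \<open>\<Lambda>\<close> itself makes those of \<open>\<Lambda>\<^sub>j\<close> and \<open>\<Lambda>\<^sub>j\<^sub>-\<^sub>1\<close>
  comparable entry by entry. The coefficients agree because a path of degree \<open>e\<^sub>i\<close> in \<open>\<Lambda>\<close> has exactly
  one counterpart in \<open>\<Lambda>\<^sub>j\<close> whenever \<open>i \<le> j\<close>.
\<close>

lemma evans_diff_subgraph:
  "evans_diff (subgraph \<Lambda> j) j p m =
    (\<lambda>b\<in>tuples (p - 1) j. \<Sum>a\<in>tuples p j. boundary_entry (coadj \<Lambda>) b a (m a))"
  unfolding evans_diff_def
proof (intro restrict_ext sum.cong refl)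
  fix a b assume a: "a \<in> tuples p j"
  then have len: "length a = p" by (simp add: tuples_def)
  show "(\<Sum>i=1..p. frag_cmul ((-1) ^ (i + 1) * (if b = omit i a then 1 else 0))
      (coadj (subgraph \<Lambda> j) (a ! (i - 1)) (m a))) = boundary_entry (coadj \<Lambda>) b a (m a)"
    unfolding boundary_entry_def len
  proof (rule sum.cong[OF refl])
    fix i assume "i \<in> {1..p}"
    then have "a ! (i - 1) \<in> set a" using len by (intro nth_mem) auto
    then have "a ! (i - 1) \<in> {1..j}" using a by (auto simp: tuples_def)
    then show "frag_cmul ((-1) ^ (i + 1) * (if b = omit i a then 1 else 0))
          (coadj (subgraph \<Lambda> j) (a ! (i - 1)) (m a))
        = frag_cmul ((-1) ^ (i + 1) * (if b = omit i a then 1 else 0)) (coadj \<Lambda> (a ! (i - 1)) (m a))"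
      by (simp only: coadj_subgraph)
  qed
qed

lemma sum_tuples_split:
  assumes "1 \<le> j" "1 \<le> p"
  shows "(\<Sum>a\<in>tuples p j. f a) = (\<Sum>c\<in>tuples (p - 1) (j - 1). f (c @ [j])) + (\<Sum>a\<in>tuples p (j - 1). f a)"
proof -
  have "(\<Sum>a\<in>tuples p j. f a) =
      (\<Sum>a\<in>(\<lambda>c. c @ [j]) ` tuples (p - 1) (j - 1). f a) + (\<Sum>a\<in>tuples p (j - 1). f a)"
    unfolding tuples_split(1)[OF assms]
    by (rule sum.union_disjoint) (use tuples_split(2)[OF assms] in auto)
  also have "(\<Sum>a\<in>(\<lambda>c. c @ [j]) ` tuples (p - 1) (j - 1). f a) =
      (\<Sum>c\<in>tuples (p - 1) (j - 1). f (c @ [j]))"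
    by (subst sum.reindex) (auto simp: inj_on_def)
  finally show ?thesis .
qed

text \<open>
  In a row \<open>b @ [j]\<close> the columns without \<open>j\<close> vanish, and the others keep their sign when \<open>j\<close> is
  stripped from both indices.
\<close>

lemma plus_part_evans_diff:
  assumes "1 \<le> j" "2 \<le> p"
  shows "plus_part j (p - 1) (evans_diff (subgraph \<Lambda> j) j p m)
    = evans_diff (subgraph \<Lambda> (j - 1)) (j - 1) (p - 1) (plus_part j p m)"
  unfolding plus_part_def evans_diff_subgraph
proof (rule restrict_ext)
  fix b assume b: "b \<in> tuples (p - 1 - 1) (j - 1)"
  have p: "1 \<le> p" "1 \<le> p - 1" using assms by auto
  have "b @ [j] \<in> tuples (p - 1) j"
    using b by (simp only: tuples_append_iff[OF assms(1) p(2)])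
  then have "(\<lambda>b\<in>tuples (p - 1) j. \<Sum>a\<in>tuples p j. boundary_entry (coadj \<Lambda>) b a (m a)) (b @ [j])
      = (\<Sum>a\<in>tuples p j. boundary_entry (coadj \<Lambda>) (b @ [j]) a (m a))"
    by (rule restrict_apply')
  also have "\<dots> = (\<Sum>c\<in>tuples (p - 1) (j - 1). boundary_entry (coadj \<Lambda>) (b @ [j]) (c @ [j]) (m (c @ [j])))
      + (\<Sum>a\<in>tuples p (j - 1). boundary_entry (coadj \<Lambda>) (b @ [j]) a (m a))"
    by (rule sum_tuples_split[OF assms(1) p(1)])
  also have "(\<Sum>a\<in>tuples p (j - 1). boundary_entry (coadj \<Lambda>) (b @ [j]) a (m a)) = 0"
    by (intro sum.neutral ballI boundary_entry_eq_0) (use notin_set_tuples[OF assms(1)] in auto)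
  also have "(\<Sum>c\<in>tuples (p - 1) (j - 1). boundary_entry (coadj \<Lambda>) (b @ [j]) (c @ [j]) (m (c @ [j])))
      = (\<Sum>c\<in>tuples (p - 1) (j - 1). boundary_entry (coadj \<Lambda>) b c
          ((\<lambda>c\<in>tuples (p - 1) (j - 1). m (c @ [j])) c))"
    by (intro sum.cong refl)
       (simp add: boundary_entry_snoc_snoc notin_set_tuples[OF assms(1)] del: One_nat_def)
  finally show "(\<lambda>b\<in>tuples (p - 1) j. \<Sum>a\<in>tuples p j. boundary_entry (coadj \<Lambda>) b a (m a)) (b @ [j])
      = (\<Sum>c\<in>tuples (p - 1) (j - 1). boundary_entry (coadj \<Lambda>) b c
          ((\<lambda>c\<in>tuples (p - 1) (j - 1). m (c @ [j])) c))"
    by simp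
qed

text \<open>
  In row \<open>b\<close>, the columns \<open>c @ [j]\<close> contribute only for \<open>c = b\<close>, by removal of the final \<open>j\<close>. Writing
  the remaining block as a sum of entries rather than as a differential covers \<open>p = j\<close> as well,
  where this sum is empty.
\<close>

lemma minus_part_evans_diff:
  assumes "1 \<le> j" "1 \<le> p"
  shows "minus_part j (p - 1) (evans_diff (subgraph \<Lambda> j) j p m) =
    (\<lambda>b\<in>tuples (p - 1) (j - 1). frag_cmul ((-1) ^ (p + 1)) (coadj \<Lambda> j (plus_part j p m b))
      + (\<Sum>a\<in>tuples p (j - 1). boundary_entry (coadj \<Lambda>) b a (minus_part j p m a)))"
  unfolding minus_part_def evans_diff_subgraph
proof (rule restrict_ext)
  fix b assume b: "b \<in> tuples (p - 1) (j - 1)"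
  have jb: "j \<notin> set b" by (rule notin_set_tuples[OF assms(1) b])
  have len: "length b = p - 1" using b by (simp add: tuples_def)
  have sign: "(-1 :: int) ^ (p - 1) = (-1) ^ (p + 1)"
    using assms(2) by (cases p) auto
  have "b \<in> tuples (p - 1) j"
    using b tuples_minus_eq[OF assms(1), of "p - 1"] by (auto simp: tuples_minus_def)
  then have "(\<lambda>b\<in>tuples (p - 1) j. \<Sum>a\<in>tuples p j. boundary_entry (coadj \<Lambda>) b a (m a)) b
      = (\<Sum>a\<in>tuples p j. boundary_entry (coadj \<Lambda>) b a (m a))"
    by (rule restrict_apply')
  also have "\<dots> = (\<Sum>c\<in>tuples (p - 1) (j - 1). boundary_entry (coadj \<Lambda>) b (c @ [j]) (m (c @ [j])))
      + (\<Sum>a\<in>tuples p (j - 1). boundary_entry (coadj \<Lambda>) b a (m a))"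
    by (rule sum_tuples_split[OF assms])
  also have "(\<Sum>c\<in>tuples (p - 1) (j - 1). boundary_entry (coadj \<Lambda>) b (c @ [j]) (m (c @ [j])))
      = (\<Sum>c\<in>tuples (p - 1) (j - 1).
          if c = b then frag_cmul ((-1) ^ length c) (coadj \<Lambda> j (m (c @ [j]))) else 0)"
    by (simp only: boundary_entry_snoc[OF jb])
  also have "\<dots> = frag_cmul ((-1) ^ (p + 1)) (coadj \<Lambda> j (plus_part j p m b))"
    using b by (simp only: sum.delta[OF finite_tuples] if_True len sign plus_part_def restrict_apply')
  finally show "(\<lambda>b\<in>tuples (p - 1) j. \<Sum>a\<in>tuples p j. boundary_entry (coadj \<Lambda>) b a (m a)) b
      = frag_cmul ((-1) ^ (p + 1)) (coadj \<Lambda> j (plus_part j p m b))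
      + (\<Sum>a\<in>tuples p (j - 1). boundary_entry (coadj \<Lambda>) b a ((\<lambda>c\<in>tuples p (j - 1). m c) a))"
    by simp
qed

theorem theorem3p3:
  fixes k j p :: nat
    and \<Lambda> :: "('o, 'm) graded_cat"
    and m :: "nat list \<Rightarrow> ('o \<Rightarrow>\<^sub>0 int)"
  assumes "1 \<le> k"
    and "k_graph k \<Lambda>"
    and "source_free k \<Lambda>"
    and "row_finite k \<Lambda>"
    and "1 \<le> j" "j \<le> k"
    and "1 \<le> p" "p \<le> j"
    and "m \<in> carrier (evans_group (subgraph \<Lambda> j) j p)"
  shows
    "let m' = evans_diff (subgraph \<Lambda> j) j p m;
         d = evans_diff (subgraph \<Lambda> (j - 1)) (j - 1);
         x = plus_part j p m;
         y = minus_part j p m;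
         Bx = (\<lambda>c\<in>tuples (p - 1) (j - 1). frag_cmul ((-1) ^ (p + 1)) (coadj \<Lambda> j (x c)))
     in (2 \<le> p \<longrightarrow> plus_part j (p - 1) m' = d (p - 1) x) \<and>
        minus_part j (p - 1) m' =
          (if p < j then Bx \<otimes>\<^bsub>evans_group (subgraph \<Lambda> (j - 1)) (j - 1) (p - 1)\<^esub> d p y else Bx)"
proof -
  define Bx where
    "Bx = (\<lambda>c\<in>tuples (p - 1) (j - 1). frag_cmul ((-1) ^ (p + 1)) (coadj \<Lambda> j (plus_part j p m c)))"
  have minus: "minus_part j (p - 1) (evans_diff (subgraph \<Lambda> j) j p m) =
      (if p < j then Bx \<otimes>\<^bsub>evans_group (subgraph \<Lambda> (j - 1)) (j - 1) (p - 1)\<^esub>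
          evans_diff (subgraph \<Lambda> (j - 1)) (j - 1) p (minus_part j p m) else Bx)"
  proof (cases "p < j")
    case True
    then show ?thesis
      unfolding minus_part_evans_diff[OF \<open>1 \<le> j\<close> \<open>1 \<le> p\<close>] mult_evans_group Bx_def
        evans_diff_subgraph[of \<Lambda> "j - 1"]
      by (auto intro!: restrict_ext)
  next
    case False
    then have "tuples p (j - 1) = {}" using \<open>1 \<le> j\<close> by (intro tuples_empty) auto
    then show ?thesis
      using False unfolding minus_part_evans_diff[OF \<open>1 \<le> j\<close> \<open>1 \<le> p\<close>] Bx_def by simp
  qed
  show ?thesis
    unfolding Let_def Bx_def[symmetric]
    using plus_part_evans_diff[OF \<open>1 \<le> j\<close>] minus by blast
qed

end
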